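(* For any link $K$, the dance-over index equals the dance-under index: $da^o(K)=da^u(K)$.
   Context: Let $D$ be an oriented link diagram. An $n$-dance-over configuration (resp. $n$-dance-under configuration) of $D$ consists of $n$ distinct initial points on $D$, away from crossings, such that: (1) one dancer starts at each of the $n$ initial points; (2) each dancer travels along its component in the direction of the orientation and stops at the next initial point (its own initial point if there is only one on that component), and the paths of all dancers together traverse the entire diagram with no overlap, so every component carries at least one initial point; (3) the speeds of the dancers may vary (waiting is allowed) and can be chosen so that the simultaneous tracing of $D$ obeys the over-first rule (resp. under-first rule) at every crossing. Over-first rule: at every crossing, the passage along the over-strand happens before the passage along the under-strand (by the same or different dancers). Under-first rule: at every crossing, the passage along the under-strand happens before the passage along the over-strand. The over-first (resp. under-first) danceability number $da^o(D)$ (resp. $da^u(D)$) is the minimum $n$ such that $D$ has an $n$-dance-over (resp. $n$-dance-under) configuration. For an unoriented link $K$, the dance-over index $da^o(K)$ (resp. dance-under index $da^u(K)$) is the minimum of $da^o(D)$ (resp. $da^u(D)$) over all diagrams $D$ representing $K$, with any choice of orientation. *)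

theory Defs
  imports "HOL-Analysis.Analysis" "HOL-Library.Extended_Nat"
begin

section \<open>Links in three-space\<close>

definition smooth_curve :: "(real \<Rightarrow> 'a::real_normed_vector) \<Rightarrow> bool" where
  "smooth_curve c \<longleftrightarrow>
     (\<exists>d. d 0 = c \<and> (\<forall>k t. (d k has_vector_derivative d (Suc k) t) (at t)))"

text \<open>A closed curve is a 1-periodic function on the reals, oriented by increasing parameter. The
  disjoint union of \<open>m\<close> circles is encoded as the set of pairs (component, parameter in \<open>[0,1)\<close>).\<close>

definition smooth_closed_curve :: "(real \<Rightarrow> 'a::real_normed_vector) \<Rightarrow> bool" where
  "smooth_closed_curve c \<longleftrightarrow>
     smooth_curve c \<and> (\<forall>t. c (t + 1) = c t) \<and> (\<forall>t. vector_derivative c (at t) \<noteq> 0)"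

definition circle_points :: "nat \<Rightarrow> (nat \<times> real) set" where
  "circle_points m = {..<m} \<times> {0..<1}"

definition link_embedding :: "nat \<Rightarrow> (nat \<Rightarrow> real \<Rightarrow> real^3) \<Rightarrow> bool" where
  "link_embedding m c \<longleftrightarrow>
     m \<ge> 1 \<and> (\<forall>i<m. smooth_closed_curve (c i)) \<and>
     inj_on (\<lambda>(i, t). c i t) (circle_points m)"

definition ambient_isotopic :: "(real^3) set \<Rightarrow> (real^3) set \<Rightarrow> bool" where
  "ambient_isotopic K L \<longleftrightarrow>
     (\<exists>h :: real \<Rightarrow> real^3 \<Rightarrow> real^3.
        continuous_on ({0..1} \<times> UNIV) (\<lambda>(t, x). h t x) \<and>
        (\<forall>t\<in>{0..1}. \<exists>g. homeomorphism UNIV UNIV (h t) g) \<and>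
        (\<forall>x. h 0 x = x) \<and> h 1 ` K = L)"

text \<open>Unoriented tame links: subsets of space ambient isotopic to a smooth link. Polygonal links
  are included.\<close>

definition link :: "(real^3) set \<Rightarrow> bool" where
  "link K \<longleftrightarrow>
     (\<exists>m c. link_embedding m c \<and> ambient_isotopic (\<Union>i<m. range (c i)) K)"


section \<open>Oriented link diagrams\<close>

text \<open>\<open>(x, y) \<in> over D\<close> says that \<open>x\<close> and \<open>y\<close> are the two points of the circles lying over some
  crossing, \<open>x\<close> on the over-strand and \<open>y\<close> on the under-strand.\<close>

record diagram =
  ncomps :: nat
  strand :: "nat \<Rightarrow> real \<Rightarrow> real^2"
  over :: "((nat \<times> real) \<times> (nat \<times> real)) set"

definition diagram_point :: "diagram \<Rightarrow> nat \<times> real \<Rightarrow> real^2" where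
  "diagram_point D x = strand D (fst x) (snd x)"

definition velocity :: "diagram \<Rightarrow> nat \<times> real \<Rightarrow> real^2" where
  "velocity D x = vector_derivative (strand D (fst x)) (at (snd x))"

definition double_points :: "diagram \<Rightarrow> ((nat \<times> real) \<times> (nat \<times> real)) set" where
  "double_points D =
     {(x, y). x \<in> circle_points (ncomps D) \<and> y \<in> circle_points (ncomps D) \<and>
              x \<noteq> y \<and> diagram_point D x = diagram_point D y}"

definition link_diagram :: "diagram \<Rightarrow> bool" where
  "link_diagram D \<longleftrightarrow>
     ncomps D \<ge> 1 \<and>
     (\<forall>i<ncomps D. smooth_closed_curve (strand D i)) \<and>
     finite (double_points D) \<and>
     (\<forall>x y z. (x, y) \<in> double_points D \<and> (x, z) \<in> double_points D \<longrightarrow> y = z) \<and>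
     (\<forall>(x, y)\<in>double_points D. velocity D x \<notin> span {velocity D y}) \<and>
     over D \<subseteq> double_points D \<and>
     (\<forall>(x, y)\<in>double_points D. (x, y) \<in> over D \<longleftrightarrow> (y, x) \<notin> over D)"

definition plane_proj :: "real^3 \<Rightarrow> real^2" where
  "plane_proj p = vector [p $ 1, p $ 2]"

text \<open>Only the underlying set of the link is compared with \<open>K\<close>, so a diagram represents \<open>K\<close>
  regardless of the orientation it carries.\<close>

definition represents :: "diagram \<Rightarrow> (real^3) set \<Rightarrow> bool" where
  "represents D K \<longleftrightarrow>
     (\<exists>c. link_embedding (ncomps D) c \<and>
          (\<forall>i<ncomps D. \<forall>t. plane_proj (c i t) = strand D i t) \<and>
          (\<forall>((i, s), (j, u))\<in>over D. c i s $ 3 > c j u $ 3) \<and>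
          ambient_isotopic (\<Union>i<ncomps D. range (c i)) K)"


section \<open>Dancing\<close>

definition initial_points :: "diagram \<Rightarrow> (nat \<times> real) set \<Rightarrow> bool" where
  "initial_points D P \<longleftrightarrow>
     finite P \<and> P \<subseteq> circle_points (ncomps D) \<and>
     (\<forall>x\<in>P. \<forall>y. (x, y) \<notin> double_points D) \<and>
     (\<forall>i<ncomps D. \<exists>t. (i, t) \<in> P)"

text \<open>The parameter, lifted to the reals, of the next initial point met after \<open>p\<close>; it is
  \<open>snd p + 1\<close> if \<open>p\<close> is the only initial point on its component.\<close>

definition next_stop :: "(nat \<times> real) set \<Rightarrow> nat \<times> real \<Rightarrow> real" where
  "next_stop P p = Inf {s. s > snd p \<and> (fst p, frac s) \<in> P}"

text \<open>The dance takes place during the time interval \<open>[0,1]\<close>; \<open>pos p t\<close> is the lifted parameter at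
  time \<open>t\<close> of the dancer who started at \<open>p\<close>. Monotonicity need not be strict: dancers may wait.\<close>

definition choreography ::
    "(nat \<times> real) set \<Rightarrow> (nat \<times> real \<Rightarrow> real \<Rightarrow> real) \<Rightarrow> bool" where
  "choreography P pos \<longleftrightarrow>
     (\<forall>p\<in>P. continuous_on {0..1} (pos p) \<and> mono_on {0..1} (pos p) \<and>
            pos p 0 = snd p \<and> pos p 1 = next_stop P p)"

definition danced_at ::
    "(nat \<times> real) set \<Rightarrow> (nat \<times> real \<Rightarrow> real \<Rightarrow> real) \<Rightarrow> nat \<times> real \<Rightarrow> real \<Rightarrow> bool" where
  "danced_at P pos x t \<longleftrightarrow>
     t \<in> {0..1} \<and> (\<exists>p\<in>P. fst p = fst x \<and> frac (pos p t) = snd x)"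

definition passed_before ::
    "(nat \<times> real) set \<Rightarrow> (nat \<times> real \<Rightarrow> real \<Rightarrow> real) \<Rightarrow> nat \<times> real \<Rightarrow> nat \<times> real \<Rightarrow> bool" where
  "passed_before P pos x y \<longleftrightarrow>
     (\<forall>t u. danced_at P pos x t \<and> danced_at P pos y u \<longrightarrow> t < u)"

definition over_first_rule ::
    "diagram \<Rightarrow> (nat \<times> real) set \<Rightarrow> (nat \<times> real \<Rightarrow> real \<Rightarrow> real) \<Rightarrow> bool" where
  "over_first_rule D P pos \<longleftrightarrow> (\<forall>(x, y)\<in>over D. passed_before P pos x y)"

definition under_first_rule ::
    "diagram \<Rightarrow> (nat \<times> real) set \<Rightarrow> (nat \<times> real \<Rightarrow> real \<Rightarrow> real) \<Rightarrow> bool" where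
  "under_first_rule D P pos \<longleftrightarrow> (\<forall>(x, y)\<in>over D. passed_before P pos y x)"

definition dance_over_configuration :: "diagram \<Rightarrow> nat \<Rightarrow> (nat \<times> real) set \<Rightarrow> bool" where
  "dance_over_configuration D n P \<longleftrightarrow>
     initial_points D P \<and> card P = n \<and> (\<exists>pos. choreography P pos \<and> over_first_rule D P pos)"

definition dance_under_configuration :: "diagram \<Rightarrow> nat \<Rightarrow> (nat \<times> real) set \<Rightarrow> bool" where
  "dance_under_configuration D n P \<longleftrightarrow>
     initial_points D P \<and> card P = n \<and> (\<exists>pos. choreography P pos \<and> under_first_rule D P pos)"

text \<open>The minima are infima in the extended naturals, where every nonempty set attains its infimum;
  a minimum over the empty set would be \<open>\<infinity>\<close>.\<close>

definition da_over :: "diagram \<Rightarrow> enat" where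
  "da_over D = (INF n\<in>{n. \<exists>P. dance_over_configuration D n P}. enat n)"

definition da_under :: "diagram \<Rightarrow> enat" where
  "da_under D = (INF n\<in>{n. \<exists>P. dance_under_configuration D n P}. enat n)"

definition dance_over_index :: "(real^3) set \<Rightarrow> enat" where
  "dance_over_index K = (INF D\<in>{D. link_diagram D \<and> represents D K}. da_over D)"

definition dance_under_index :: "(real^3) set \<Rightarrow> enat" where
  "dance_under_index K = (INF D\<in>{D. link_diagram D \<and> represents D K}. da_under D)"

end

theory Submission
  imports Defs
begin

text \<open>Viewing a link from behind, that is, after a half turn about the first coordinate axis,
  reflects the diagram and exchanges the over- and under-strand of every crossing. The half turn is
  isotopic to the identity, so the new diagram represents the same link, and a dance on the old
  diagram that obeys the over-first rule is a dance on the new one that obeys the under-first rule.\<close>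

lemma smooth_curve_linear_image:
  assumes "bounded_linear f" "smooth_curve c"
  shows "smooth_curve (\<lambda>t. f (c t))"
proof -
  obtain d where d: "d 0 = c" "\<And>k t. (d k has_vector_derivative d (Suc k) t) (at t)"
    using assms(2) unfolding smooth_curve_def by blast
  show ?thesis
    unfolding smooth_curve_def
    \<comment> \<open>A bounded linear map commutes with differentiation, so applying it to the
      whole tower of derivatives of \<open>c\<close> gives the tower of the image curve.\<close>
    by (rule exI[of _ "\<lambda>k t. f (d k t)"])
      (auto simp: d(1) intro: bounded_linear.has_vector_derivative[OF assms(1) d(2)])
qed

lemma smooth_curve_has_vector_derivative:
  assumes "smooth_curve c"
  shows "(c has_vector_derivative vector_derivative c (at t)) (at t)"
  using assms unfolding smooth_curve_def by (metis vector_derivative_at)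

lemma vector_derivative_linear_image:
  assumes "bounded_linear f" "smooth_curve c"
  shows "vector_derivative (\<lambda>t. f (c t)) (at t) = f (vector_derivative c (at t))"
  by (intro vector_derivative_at bounded_linear.has_vector_derivative[OF assms(1)]
      smooth_curve_has_vector_derivative assms(2))

lemma smooth_closed_curve_linear_image:
  assumes "bounded_linear f" "inj f" "smooth_closed_curve c"
  shows "smooth_closed_curve (\<lambda>t. f (c t))"
proof -
  interpret bounded_linear f by fact
  \<comment> \<open>Injectivity keeps the velocity of the image curve away from zero.\<close>
  have "f v \<noteq> 0" if "v \<noteq> 0" for v
    using that assms(2) zero by (metis injD)
  then show ?thesis
    using assms(3) smooth_curve_linear_image[OF assms(1), of c]
      vector_derivative_linear_image[OF assms(1), of c]
    unfolding smooth_closed_curve_def by simp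
qed

text \<open>The two motions run simultaneously rather than one after the other: \<open>h t\<close>
  after \<open>r t\<close> is again an isotopy starting at the identity, with no gluing or rescaling
  of time.\<close>

lemma ambient_isotopic_precompose:
  fixes r :: "real \<Rightarrow> real^3 \<Rightarrow> real^3"
  assumes "continuous_on ({0..1} \<times> UNIV) (\<lambda>(t, x). r t x)"
    and "\<And>t. t \<in> {0..1} \<Longrightarrow> \<exists>g. homeomorphism UNIV UNIV (r t) g"
    and "\<And>x. r 0 x = x"
    and "ambient_isotopic (r 1 ` L) K"
  shows "ambient_isotopic L K"
proof -
  obtain h where h: "continuous_on ({0..1} \<times> UNIV) (\<lambda>(t, x). h t x :: real^3)"
    "\<forall>t\<in>{0..1::real}. \<exists>g. homeomorphism UNIV UNIV (h t) g"
    "\<forall>x. h 0 x = x" "h 1 ` r 1 ` L = K"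
    using assms(4) unfolding ambient_isotopic_def by blast
  have "continuous_on ({0..1} \<times> UNIV) (\<lambda>z. (\<lambda>(t, x). h t x) (fst z, (\<lambda>(t, x). r t x) z))"
    by (rule continuous_on_compose2[OF h(1)])
      (use assms(1) in \<open>auto intro!: continuous_intros\<close>)
  then have "continuous_on ({0..1} \<times> UNIV) (\<lambda>(t, x). h t (r t x))"
    by (simp add: case_prod_unfold)
  moreover have "\<exists>g. homeomorphism UNIV UNIV (\<lambda>x. h t (r t x)) g" if "t \<in> {0..1}" for t
    using assms(2)[OF that] h(2) that homeomorphism_compose unfolding comp_def by blast
  moreover have "(\<lambda>x. h 1 (r 1 x)) ` L = K"
    using h(4) by (simp add: image_image)
  ultimately show ?thesis
    unfolding ambient_isotopic_def using h(3) assms(3)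
    by (intro exI[of _ "\<lambda>t x. h t (r t x)"]) auto
qed

text \<open>The angle is a parameter so that the same family supplies both the half turn and the
  isotopy leading to it.\<close>

definition rotation :: "real \<Rightarrow> real^3 \<Rightarrow> real^3" where
  "rotation a p =
     vector [p $ 1, cos a * p $ 2 - sin a * p $ 3, sin a * p $ 2 + cos a * p $ 3]"

definition reflection :: "real^2 \<Rightarrow> real^2" where
  "reflection p = vector [p $ 1, - p $ 2]"

lemma linear_rotation: "linear (rotation a)"
  by (rule linearI) (simp_all add: rotation_def vec_eq_iff forall_3 algebra_simps)

lemma linear_reflection: "linear reflection"
  by (rule linearI) (simp_all add: reflection_def vec_eq_iff forall_2)

lemma rotation_0 [simp]: "rotation 0 p = p"
  by (simp add: rotation_def vec_eq_iff forall_3)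

lemma rotation_rotation: "rotation a (rotation b p) = rotation (a + b) p"
  by (simp add: rotation_def vec_eq_iff forall_3 cos_add sin_add algebra_simps)

lemma rotation_pi: "rotation pi p = vector [p $ 1, - p $ 2, - p $ 3]"
  by (simp add: rotation_def)

lemma rotation_pi_pi [simp]: "rotation pi (rotation pi p) = p"
  by (simp add: rotation_pi vec_eq_iff forall_3)

lemma reflection_reflection [simp]: "reflection (reflection p) = p"
  by (simp add: reflection_def vec_eq_iff forall_2)

lemma inj_rotation_pi: "inj (rotation pi)"
  by (metis injI rotation_pi_pi)

lemma inj_reflection: "inj reflection"
  by (metis injI reflection_reflection)

text \<open>The half turn negates the second and third coordinates; the projection forgets the
  third, so only the sign change of the second is visible in the plane.\<close>

lemma plane_proj_rotation_pi: "plane_proj (rotation pi p) = reflection (plane_proj p)"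
  by (simp add: plane_proj_def rotation_pi reflection_def)

lemma homeomorphism_rotation: "homeomorphism UNIV UNIV (rotation a) (rotation (- a))"
proof -
  have "continuous_on UNIV (rotation b)" for b
    by (simp add: linear_continuous_on linear_conv_bounded_linear[symmetric] linear_rotation)
  then show ?thesis
    by (intro homeomorphismI) (auto simp: rotation_rotation)
qed

lemma continuous_on_rotation: "continuous_on S (\<lambda>(t, x). rotation (pi * t) x)"
proof -
  \<comment> \<open>Joint continuity in time and point is checked coordinatewise, where only sums
    and products of continuous functions occur.\<close>
  have "\<forall>i. continuous_on S (\<lambda>z. rotation (pi * fst z) (snd z) $ i)"
    unfolding forall_3 rotation_def vector_3 by (intro conjI continuous_intros)
  then have "continuous_on S (\<lambda>z. \<chi> i. rotation (pi * fst z) (snd z) $ i)"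
    by (intro continuous_on_vec_lambda) blast
  then show ?thesis
    by (simp add: case_prod_unfold)
qed

lemma ambient_isotopic_rotation_pi:
  assumes "ambient_isotopic L K"
  shows "ambient_isotopic (rotation pi ` L) K"
proof (rule ambient_isotopic_precompose[where r = "\<lambda>t. rotation (pi * t)"])
  \<comment> \<open>A second half turn carries the rotated link back to \<open>L\<close>, from which
    the given isotopy leads to \<open>K\<close>.\<close>
  show "ambient_isotopic (rotation (pi * 1) ` rotation pi ` L) K"
    using assms by (simp add: image_image)
qed (use homeomorphism_rotation in \<open>auto simp: continuous_on_rotation\<close>)

text \<open>Components keep their parametrisation, so initial points and choreographies carry over
  verbatim.\<close>

definition flip :: "diagram \<Rightarrow> diagram" where
  "flip D = D\<lparr>strand := \<lambda>i t. reflection (strand D i t), over := (over D)\<inverse>\<rparr>"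

lemma flip_simps [simp]:
  "ncomps (flip D) = ncomps D"
  "strand (flip D) i t = reflection (strand D i t)"
  "over (flip D) = (over D)\<inverse>"
  by (simp_all add: flip_def)

lemma double_points_flip [simp]: "double_points (flip D) = double_points D"
  by (simp add: double_points_def diagram_point_def inj_eq[OF inj_reflection])

lemma double_points_sym: "(x, y) \<in> double_points D \<Longrightarrow> (y, x) \<in> double_points D"
  by (auto simp: double_points_def)

text \<open>Smoothness is assumed because \<open>vector_derivative\<close> is an arbitrary value
  where no derivative exists.\<close>

lemma velocity_flip:
  assumes "smooth_curve (strand D (fst x))"
  shows "velocity (flip D) x = reflection (velocity D x)"
  using vector_derivative_linear_image[OF _ assms, of reflection] linear_reflection
  by (simp add: velocity_def flip_def linear_conv_bounded_linear)

text \<open>This keeps crossings transversal: an injective linear map preserves and reflects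
  membership in a span.\<close>

lemma reflection_span: "reflection v \<in> span {reflection w} \<longleftrightarrow> v \<in> span {w}"
  using linear_span_image[OF linear_reflection, of "{w}"] inj_image_mem_iff[OF inj_reflection]
  by simp

lemma link_diagram_flip:
  assumes "link_diagram D"
  shows "link_diagram (flip D)"
proof -
  have D: "ncomps D \<ge> 1" "\<forall>i<ncomps D. smooth_closed_curve (strand D i)"
    "finite (double_points D)"
    "\<forall>x y z. (x, y) \<in> double_points D \<and> (x, z) \<in> double_points D \<longrightarrow> y = z"
    "\<forall>(x, y)\<in>double_points D. velocity D x \<notin> span {velocity D y}"
    "over D \<subseteq> double_points D"
    "\<forall>(x, y)\<in>double_points D. (x, y) \<in> over D \<longleftrightarrow> (y, x) \<notin> over D"
    using assms unfolding link_diagram_def atomize_conj by (elim conjE) (intro conjI; assumption)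
  have "smooth_closed_curve (strand (flip D) i)" if "i < ncomps D" for i
    using smooth_closed_curve_linear_image[OF _ inj_reflection, of "strand D i"]
      linear_reflection D(2) that
    by (simp add: flip_def linear_conv_bounded_linear)
  moreover have "velocity (flip D) x \<notin> span {velocity (flip D) y}"
    if "(x, y) \<in> double_points D" for x y
  proof -
    have "fst x < ncomps D" "fst y < ncomps D"
      using that by (auto simp: double_points_def circle_points_def)
    then have "smooth_curve (strand D (fst x))" "smooth_curve (strand D (fst y))"
      using D(2) by (auto simp: smooth_closed_curve_def)
    then show ?thesis
      using D(5) that by (auto simp add: velocity_flip reflection_span)
  qed
  moreover have "over (flip D) \<subseteq> double_points D"
    using D(6) double_points_sym by fastforce
  \<comment> \<open>That exactly one of the two orderings of a crossing lies in
    \<open>over D\<close> is a condition symmetric in \<open>x\<close> and \<open>y\<close>, so it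
    survives taking the converse.\<close>
  moreover have "(x, y) \<in> over (flip D) \<longleftrightarrow> (y, x) \<notin> over (flip D)"
    if "(x, y) \<in> double_points D" for x y
    using bspec[OF D(7) that] unfolding prod.case flip_simps converse_iff by blast
  ultimately show ?thesis
    unfolding link_diagram_def double_points_flip flip_simps(1)
    using D(1,3,4) by (intro conjI) (fast | assumption)+
qed

lemma represents_flip:
  assumes "represents D K"
  shows "represents (flip D) K"
proof -
  obtain c where c: "link_embedding (ncomps D) c"
    "\<forall>i<ncomps D. \<forall>t. plane_proj (c i t) = strand D i t"
    "\<forall>((i, s), (j, u))\<in>over D. c i s $ 3 > c j u $ 3"
    "ambient_isotopic (\<Union>i<ncomps D. range (c i)) K"
    using assms unfolding represents_def by blast
  \<comment> \<open>The lift of the flipped diagram is the turned lift of \<open>D\<close>. Heights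
    change sign, which matches the converse of \<open>over D\<close>.\<close>
  let ?c = "\<lambda>i t. rotation pi (c i t)"
  have "bounded_linear (rotation pi)"
    using linear_rotation by (simp add: linear_conv_bounded_linear)
  then have "link_embedding (ncomps D) ?c"
    using c(1) smooth_closed_curve_linear_image[OF _ inj_rotation_pi]
    by (simp add: link_embedding_def inj_on_def inj_eq[OF inj_rotation_pi] case_prod_unfold)
  moreover have "ambient_isotopic (\<Union>i<ncomps D. range (?c i)) K"
    using ambient_isotopic_rotation_pi[OF c(4)] by (simp add: image_UN image_image)
  moreover have "\<forall>((i, s), (j, u))\<in>(over D)\<inverse>. ?c i s $ 3 > ?c j u $ 3"
    using c(3) by (auto simp: rotation_pi)
  ultimately show ?thesis
    unfolding represents_def using c(2)
    by (intro exI[of _ ?c]) (simp add: plane_proj_rotation_pi)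
qed

lemma initial_points_flip [simp]: "initial_points (flip D) = initial_points D"
  by (simp add: initial_points_def fun_eq_iff)

text \<open>\<open>passed_before\<close> does not refer to the diagram, so only the order within
  each crossing pair changes, and one choreography serves both rules.\<close>

lemma over_first_rule_flip [simp]: "over_first_rule (flip D) = under_first_rule D"
  by (auto simp: over_first_rule_def under_first_rule_def fun_eq_iff)

lemma under_first_rule_flip [simp]: "under_first_rule (flip D) = over_first_rule D"
  by (auto simp: over_first_rule_def under_first_rule_def fun_eq_iff)

lemma da_over_flip: "da_over (flip D) = da_under D"
  by (simp add: da_over_def da_under_def dance_over_configuration_def
      dance_under_configuration_def)

lemma da_under_flip: "da_under (flip D) = da_over D"
  by (simp add: da_over_def da_under_def dance_over_configuration_def
      dance_under_configuration_def)

theorem corollary2p5: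
  fixes K :: "(real^3) set"
  assumes "link K"
  shows "dance_over_index K = dance_under_index K"
proof (rule antisym)
  show "dance_over_index K \<le> dance_under_index K"
    unfolding dance_over_index_def dance_under_index_def
    \<comment> \<open>Each diagram \<open>D\<close> competing on the right is matched on the left by
      \<open>flip D\<close>, which has the same value.\<close>
    by (intro INF_mono) (metis mem_Collect_eq da_over_flip link_diagram_flip represents_flip order_refl)
  show "dance_under_index K \<le> dance_over_index K"
    unfolding dance_over_index_def dance_under_index_def
    by (intro INF_mono) (metis mem_Collect_eq da_under_flip link_diagram_flip represents_flip order_refl)
qed

end
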